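(* For every integer $d\ge1$, every even integer $\kappa\ge2$ and every integer $m\ge0$: if $E\in\boldsymbol{\Theta}_{m,\kappa}(D[d])$ and $0\le j\le \frac{\kappa}{2}-1$, then $\pm\cos\left(\frac{j\pi}{\kappa}\right)\cdot E\in\boldsymbol{\Theta}_{m,\kappa}(D[d+1])$. In other words, $$\Big\{\pm\cos\big(\tfrac{j\pi}{\kappa}\big):0\le j\le\tfrac{\kappa}{2}-1\Big\}\times\boldsymbol{\Theta}_{m,\kappa}(D[d])\subset\boldsymbol{\Theta}_{m,\kappa}(D[d+1]),$$ where $\times$ denotes the set of products of real numbers.
   Context: $D[d]=\prod_{i=1}^d \frac12(S_i+S_i^* )$ is the Molchanov--Vainberg Laplacian on $\ell^2(\mathbb{Z}^d)$ ($S_i$ the unit shift in the $i$-th coordinate), with spectrum $[-1,1]$. Let $U_n$ be the Chebyshev polynomial of the second kind, $U_{n-1}(\cos\theta)=\sin(n\theta)/\sin\theta$. For $j\in\mathbb{N}^*=\{1,2,\ldots\}$ and $\vec{x}=(x_1,\ldots,x_d)\in[-1,1]^d$ let $g_{j\kappa}(\vec{x}) = \sum_{i=1}^d \big(\prod_{l\neq i}x_l\big)(1-x_i^2)U_{j\kappa-1}(x_i)$, and $S_E=\{\vec{x}\in[-1,1]^d:\prod_{l=1}^d x_l=E\}$. $\boldsymbol{\Theta}_{0,\kappa}(D[d])$ is the set of $E\in[-1,1]$ such that there is $\vec{x}\in S_E$ with $g_{j\kappa}(\vec{x})=0$ for all $j\in\mathbb{N}^*$. For $m\in\mathbb{N}^*$,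 $\boldsymbol{\Theta}_{m,\kappa}(D[d])$ is the set of $E\in[-1,1]$ such that there are $\vec{x}_0,\ldots,\vec{x}_m\in S_E$ and reals $\omega_0,\ldots,\omega_{m-1}\le0$ with $g_{j\kappa}(\vec{x}_m)=\sum_{q=0}^{m-1}\omega_q\,g_{j\kappa}(\vec{x}_q)$ for all $j\in\mathbb{N}^*$. *)

theory Defs
  imports Complex_Main "HOL-Library.FuncSet" "HOL-Library.Set_Algebras"
    "HOL-Computational_Algebra.Polynomial"
begin

fun Cheb_U :: "nat \<Rightarrow> real poly" where
  "Cheb_U 0 = 1"
| "Cheb_U (Suc 0) = [:0, 2:]"
| "Cheb_U (Suc (Suc n)) = [:0, 2:] * Cheb_U (Suc n) - Cheb_U n"

lemma Cheb_U_cos_mult_sin: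
  "poly (Cheb_U n) (cos \<theta>) * sin \<theta> = sin (real (Suc n) * \<theta>)"
proof (induction n rule: Cheb_U.induct)
  case 1
  then show ?case by simp
next
  case 2
  then show ?case using sin_double[of \<theta>] by simp
next
  case (3 n)
  define a where "a = real (Suc (Suc n)) * \<theta>"
  have "poly (Cheb_U (Suc (Suc n))) (cos \<theta>) * sin \<theta>
      = 2 * cos \<theta> * (poly (Cheb_U (Suc n)) (cos \<theta>) * sin \<theta>) - poly (Cheb_U n) (cos \<theta>) * sin \<theta>"
    by (simp add: algebra_simps)
  also have "\<dots> = 2 * cos \<theta> * sin a - sin (real (Suc n) * \<theta>)"
    unfolding a_def 3 ..
  also have "real (Suc n) * \<theta> = a - \<theta>"
    by (simp add: a_def algebra_simps)
  also have "2 * cos \<theta> * sin a - sin (a - \<theta>) = sin (a + \<theta>)"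
    by (simp add: sin_add sin_diff)
  also have "a + \<theta> = real (Suc (Suc (Suc n))) * \<theta>"
    by (simp add: a_def algebra_simps)
  finally show ?case .
qed

text \<open>
  Agreement with \<open>U\<^bsub>n-1\<^esub>(cos \<theta>) = sin(n\<theta>) / sin \<theta>\<close>, which determines the
  polynomial because it prescribes its values on \<open>(-1, 1)\<close>.
\<close>

lemma Cheb_U_cos:
  assumes "n \<ge> 1" and "sin \<theta> \<noteq> 0"
  shows "poly (Cheb_U (n - 1)) (cos \<theta>) = sin (real n * \<theta>) / sin \<theta>"
  using assms Cheb_U_cos_mult_sin[of "n - 1" \<theta>] by (simp add: field_simps)

text \<open>
  Points of \<open>[-1,1]\<^sup>d\<close> are functions on the index set \<open>{1..d}\<close>, extended by
  \<^const>\<open>undefined\<close> outside it, so that \<open>d\<close> can be an ordinary natural number.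
\<close>

definition cube :: "nat \<Rightarrow> (nat \<Rightarrow> real) set" where
  "cube d = {1..d} \<rightarrow>\<^sub>E {-1..1}"

text \<open>
  The function \<open>g\<^bsub>n\<^esub>\<close>, used only at positive multiples \<open>n = j\<kappa>\<close>,
  so the truncated subtraction \<open>n - 1\<close> is the true one.
\<close>

definition g :: "nat \<Rightarrow> nat \<Rightarrow> (nat \<Rightarrow> real) \<Rightarrow> real" where
  "g d n x = (\<Sum>i=1..d. (\<Prod>l\<in>{1..d} - {i}. x l) * (1 - (x i)\<^sup>2) * poly (Cheb_U (n - 1)) (x i))"

definition energy_surface :: "nat \<Rightarrow> real \<Rightarrow> (nat \<Rightarrow> real) set" where
  "energy_surface d E = {x \<in> cube d. (\<Prod>l=1..d. x l) = E}"

text \<open>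
  \<open>Theta d m \<kappa>\<close> is \<open>\<Theta>\<^bsub>m,\<kappa>\<^esub>(D[d])\<close> for the Molchanov--Vainberg Laplacian \<open>D[d]\<close>
  on \<open>\<int>\<^sup>d\<close>; the operator enters only through \<open>g\<close> and the product in
  \<^const>\<open>energy_surface\<close>.
\<close>

definition Theta :: "nat \<Rightarrow> nat \<Rightarrow> nat \<Rightarrow> real set" where
  "Theta d m \<kappa> =
    (if m = 0 then
      {E \<in> {-1..1}. \<exists>x \<in> energy_surface d E. \<forall>j\<ge>1. g d (j * \<kappa>) x = 0}
    else
      {E \<in> {-1..1}. \<exists>(x :: nat \<Rightarrow> nat \<Rightarrow> real) (\<omega> :: nat \<Rightarrow> real).
        (\<forall>q\<le>m. x q \<in> energy_surface d E) \<and> (\<forall>q<m. \<omega> q \<le> 0) \<and>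
        (\<forall>j\<ge>1. g d (j * \<kappa>) (x m) = (\<Sum>q<m. \<omega> q * g d (j * \<kappa>) (x q)))})"

end

theory Submission
  imports Defs
begin

text \<open>
  Append one coordinate \<open>c\<close> to a point \<open>x\<close> of the \<open>d\<close>-dimensional cube. The product of the
  coordinates is multiplied by \<open>c\<close>, and
  \<open>g\<^bsub>n\<^esub>(x, c) = c g\<^bsub>n\<^esub>(x) + (\<Prod>l. x\<^sub>l) (1 - c\<^sup>2) U\<^bsub>n-1\<^esub>(c)\<close>.
  For \<open>c = cos \<theta>\<close> the factor \<open>(1 - c\<^sup>2) U\<^bsub>n-1\<^esub>(c)\<close> equals \<open>sin \<theta> sin(n\<theta>)\<close>, so if
  \<open>\<theta>\<close> is a multiple of \<open>\<pi>/\<kappa>\<close>, it vanishes for every \<open>n\<close> divisible by \<open>\<kappa>\<close>. Appending such a \<open>c\<close>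
  therefore multiplies the energy and all the \<open>g\<^bsub>j\<kappa>\<^esub>\<close> by the same constant \<open>c\<close>. The
  relations that define \<open>\<Theta>\<^bsub>m,\<kappa>\<^esub>\<close> are homogeneous and linear in the values of \<open>g\<^bsub>j\<kappa>\<^esub>\<close>, so
  they survive with the same weights \<open>\<omega>\<^sub>q\<close> (lemma \<open>Theta_mult_cos\<close>). The negative factors are
  covered as well, because \<open>- cos(j\<pi>/\<kappa>) = cos((\<kappa> - j)\<pi>/\<kappa>)\<close>.
\<close>

lemma fun_upd_Suc_mem_cube:
  assumes "x \<in> cube d" and "c \<in> {-1..1}"
  shows "x(Suc d := c) \<in> cube (Suc d)"
  using assms by (auto simp: cube_def PiE_iff extensional_def)

lemma prod_fun_upd_Suc:
  fixes x :: "nat \<Rightarrow> real"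
  shows "(\<Prod>l=1..Suc d. (x(Suc d := c)) l) = c * (\<Prod>l=1..d. x l)"
  by (simp add: mult.commute)

lemma fun_upd_Suc_mem_energy_surface:
  assumes "x \<in> energy_surface d E" and "c \<in> {-1..1}"
  shows "x(Suc d := c) \<in> energy_surface (Suc d) (c * E)"
  using assms fun_upd_Suc_mem_cube prod_fun_upd_Suc[where x = x and c = c and d = d]
  by (simp add: energy_surface_def)

text \<open>
  In each summand with \<open>i \<le> d\<close> the new coordinate enters only through the product over
  \<open>l \<noteq> i\<close>, as a factor \<open>c\<close>. The summand \<open>i = d + 1\<close> omits \<open>c\<close> from its product, so it carries
  the whole energy \<open>\<Prod>l. x\<^sub>l\<close> and all the remaining dependence on \<open>c\<close>.
\<close>

lemma g_fun_upd_Suc: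
  "g (Suc d) n (x(Suc d := c)) =
    c * g d n x + (\<Prod>l=1..d. x l) * ((1 - c\<^sup>2) * poly (Cheb_U (n - 1)) c)"
proof -
  let ?y = "x(Suc d := c)"
  let ?h = "\<lambda>t::real. (1 - t\<^sup>2) * poly (Cheb_U (n - 1)) t"
  have old: "(\<Prod>l\<in>{1..Suc d} - {i}. ?y l) = c * (\<Prod>l\<in>{1..d} - {i}. x l)"
    if i: "i \<in> {1..d}" for i
  proof -
    have "{1..Suc d} - {i} = insert (Suc d) ({1..d} - {i})"
      using i by auto
    then show ?thesis by simp
  qed
  have new: "(\<Prod>l\<in>{1..Suc d} - {Suc d}. ?y l) = (\<Prod>l=1..d. x l)"
    by (rule prod.cong) auto
  have "g (Suc d) n ?y = (\<Sum>i=1..Suc d. (\<Prod>l\<in>{1..Suc d} - {i}. ?y l) * ?h (?y i))"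
    unfolding g_def by (simp only: mult.assoc)
  also have "\<dots> = (\<Sum>i=1..d. (\<Prod>l\<in>{1..Suc d} - {i}. ?y l) * ?h (?y i))
      + (\<Prod>l\<in>{1..Suc d} - {Suc d}. ?y l) * ?h (?y (Suc d))"
    by (subst sum.cl_ivl_Suc) simp
  also have "(\<Sum>i=1..d. (\<Prod>l\<in>{1..Suc d} - {i}. ?y l) * ?h (?y i))
      = (\<Sum>i=1..d. c * ((\<Prod>l\<in>{1..d} - {i}. x l) * ?h (x i)))"
    by (rule sum.cong[OF refl], subst old) (auto simp: mult.assoc)
  also have "\<dots> = c * g d n x"
    unfolding g_def by (simp add: sum_distrib_left mult.assoc)
  finally show ?thesis
    by (simp only: new fun_upd_same)
qed

text \<open>
  The factor \<open>1 - c\<^sup>2 = sin\<^sup>2 \<theta>\<close> clears the denominator in \<open>U\<^bsub>n-1\<^esub>(c) = sin(n\<theta>) / sin \<theta>\<close>, so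
  \<open>c = \<plusminus>1\<close> is no exception.
\<close>

lemma one_minus_square_mult_Cheb_U_cos:
  assumes "n \<ge> 1"
  shows "(1 - (cos \<theta>)\<^sup>2) * poly (Cheb_U (n - 1)) (cos \<theta>) = sin \<theta> * sin (real n * \<theta>)"
proof -
  have "(1 - (cos \<theta>)\<^sup>2) * poly (Cheb_U (n - 1)) (cos \<theta>)
      = sin \<theta> * (poly (Cheb_U (n - 1)) (cos \<theta>) * sin \<theta>)"
    by (simp add: sin_squared_eq[symmetric]) (simp add: power2_eq_square)
  also have "\<dots> = sin \<theta> * sin (real n * \<theta>)"
    using assms by (simp add: Cheb_U_cos_mult_sin del: of_nat_Suc)
  finally show ?thesis .
qed

lemma g_fun_upd_cos:
  assumes "\<kappa> \<ge> 1" and "j \<ge> 1"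
  shows "g (Suc d) (j * \<kappa>) (x(Suc d := cos (real k * pi / real \<kappa>)))
    = cos (real k * pi / real \<kappa>) * g d (j * \<kappa>) x"
proof -
  have "real (j * \<kappa>) * (real k * pi / real \<kappa>) = real (j * k) * pi"
    using assms by simp
  then have "sin (real (j * \<kappa>) * (real k * pi / real \<kappa>)) = 0"
    by (simp only: sin_npi)
  moreover have "j * \<kappa> \<ge> 1"
    using assms by simp
  ultimately show ?thesis
    by (simp only: g_fun_upd_Suc one_minus_square_mult_Cheb_U_cos mult_zero_right add_0_right)
qed

lemma Theta_mult_cos:
  assumes "\<kappa> \<ge> 1" and E: "E \<in> Theta d m \<kappa>"
  shows "cos (real k * pi / real \<kappa>) * E \<in> Theta (Suc d) m \<kappa>"
proof -
  define c where "c = cos (real k * pi / real \<kappa>)"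
  have c: "c \<in> {-1..1}"
    by (simp add: c_def)
  have g: "g (Suc d) (j * \<kappa>) (x(Suc d := c)) = c * g d (j * \<kappa>) x" if "j \<ge> 1" for j x
    unfolding c_def using assms(1) that by (rule g_fun_upd_cos)
  have "E \<in> {-1..1}"
    using E by (auto simp: Theta_def split: if_splits)
  then have "\<bar>c\<bar> * \<bar>E\<bar> \<le> 1"
    using c by (intro mult_le_one) auto
  then have cE: "c * E \<in> {-1..1}"
    by (simp add: abs_mult[symmetric] abs_le_iff)
  have "c * E \<in> Theta (Suc d) m \<kappa>"
  proof (cases "m = 0")
    case True
    with E obtain x where "x \<in> energy_surface d E" and "\<forall>j\<ge>1. g d (j * \<kappa>) x = 0"
      by (auto simp: Theta_def)
    then have "x(Suc d := c) \<in> energy_surface (Suc d) (c * E)"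
      and "\<forall>j\<ge>1. g (Suc d) (j * \<kappa>) (x(Suc d := c)) = 0"
      using c g by (auto intro: fun_upd_Suc_mem_energy_surface)
    with True cE show ?thesis
      unfolding Theta_def by auto
  next
    case False
    with E obtain x \<omega> where x: "\<forall>q\<le>m. x q \<in> energy_surface d E"
      and \<omega>: "\<forall>q<m. \<omega> q \<le> 0"
      and eq: "\<forall>j\<ge>1. g d (j * \<kappa>) (x m) = (\<Sum>q<m. \<omega> q * g d (j * \<kappa>) (x q))"
      by (auto simp: Theta_def)
    define y where "y q = (x q)(Suc d := c)" for q
    have "\<forall>q\<le>m. y q \<in> energy_surface (Suc d) (c * E)"
      using x c by (auto simp: y_def intro: fun_upd_Suc_mem_energy_surface)
    moreover have "\<forall>j\<ge>1. g (Suc d) (j * \<kappa>) (y m) = (\<Sum>q<m. \<omega> q * g (Suc d) (j * \<kappa>) (y q))"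
      using eq by (simp add: y_def g sum_distrib_left mult.left_commute)
    ultimately show ?thesis
      using False cE \<omega> unfolding Theta_def by auto
  qed
  then show ?thesis
    by (simp add: c_def)
qed

theorem lemma1p13:
  fixes d \<kappa> m :: nat
  assumes "d \<ge> 1" and "even \<kappa>" and "\<kappa> \<ge> 2"
  shows "(\<forall>E j. E \<in> Theta d m \<kappa> \<longrightarrow> j \<le> \<kappa> div 2 - 1 \<longrightarrow>
            cos (real j * pi / real \<kappa>) * E \<in> Theta (d + 1) m \<kappa> \<and>
            - cos (real j * pi / real \<kappa>) * E \<in> Theta (d + 1) m \<kappa>) \<and>
         (\<Union>j\<in>{0..\<kappa> div 2 - 1}. {cos (real j * pi / real \<kappa>), - cos (real j * pi / real \<kappa>)})
           * Theta d m \<kappa> \<subseteq> Theta (d + 1) m \<kappa>"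
proof -
  have both: "cos (real j * pi / real \<kappa>) * E \<in> Theta (d + 1) m \<kappa> \<and>
      - cos (real j * pi / real \<kappa>) * E \<in> Theta (d + 1) m \<kappa>"
    if E: "E \<in> Theta d m \<kappa>" and j: "j \<le> \<kappa> div 2 - 1" for E j
  proof -
    have "real (\<kappa> - j) * pi / real \<kappa> = pi - real j * pi / real \<kappa>"
      using j \<open>\<kappa> \<ge> 2\<close> by (simp add: of_nat_diff field_simps)
    then have "cos (real (\<kappa> - j) * pi / real \<kappa>) = - cos (real j * pi / real \<kappa>)"
      by simp
    then show ?thesis
      using Theta_mult_cos[of \<kappa> E d m j] Theta_mult_cos[of \<kappa> E d m "\<kappa> - j"] E \<open>\<kappa> \<ge> 2\<close>
      by simp
  qed
  moreover have "(\<Union>j\<in>{0..\<kappa> div 2 - 1}. {cos (real j * pi / real \<kappa>), - cos (real j * pi / real \<kappa>)})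
      * Theta d m \<kappa> \<subseteq> Theta (d + 1) m \<kappa>"
    by (rule subsetI, erule set_times_elim) (use both in auto)
  ultimately show ?thesis
    by blast
qed

end
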